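(* Let $f:\mathbb{R}^d\to\mathbb{R}$ be a $C^2$ function having a unique global minimum $x^*\in\mathbb{R}^d$, and assume that there exist $a,b>0$ such that, for all $x\in\mathbb{R}^d$, $$a\big[f(x)-f(x^* )\big]+b\|x-x^*\|^2\le (x-x^* )\cdot\big(\nabla f(x)-\nabla f(x^* )\big).$$ Let $\gamma>0$, $\alpha>0$, $\rho>0$. Then, for any initial condition $(x_0,p_0,\xi_0)\in\mathbb{R}^d\times\mathbb{R}^d\times\mathbb{R}_+^d$, there exist $\kappa>0$ and $C\in\mathbb{R}_+$ such that the solution $(x(t),p(t),\xi(t))$, started from $(x_0,p_0,\xi_0)$ at time $t=0$, of the iKFAD system $$\dot x=p,\qquad \dot p=-\nabla f(x)-\gamma p-\xi\star p,\qquad \dot\xi=\frac{[p]^2}{\rho}-\alpha\xi$$ satisfies, for all $t\ge 0$, $$f(x(t))-f(x^* )+\|p(t)\|+\|\xi(t)\|\le C\,\mathrm{e}^{-\kappa t}.$$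
   Context: Here $x,p,\xi$ take values in $\mathbb{R}^d$; $\|\cdot\|$ is the Euclidean norm and $\cdot$ the Euclidean inner product; $\star$ denotes element-wise (Hadamard) multiplication of vectors, and $[p]^k$ denotes the element-wise $k$-th power of the vector $p$. $\mathbb{R}_+=[0,\infty)$, so $\xi_0\in\mathbb{R}_+^d$ has nonnegative components. The constants $\kappa$ and $C$ may depend on the initial condition. *)

theory Defs
  imports "HOL-Analysis.Analysis"
begin

definition grad :: "('a::real_inner \<Rightarrow> real) \<Rightarrow> 'a \<Rightarrow> 'a" where
  "grad f x = (THE D. GDERIV f x :> D)"

lemma grad_eqI: "GDERIV f x :> D \<Longrightarrow> grad f x = D"
proof -
  assume D: "GDERIV f x :> D"
  have "E = D" if "GDERIV f x :> E" for E
  proof -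
    have "(\<lambda>h. inner h E) = (\<lambda>h. inner h D)"
      using that D unfolding gderiv_def by (rule has_derivative_unique)
    then have "inner h (E - D) = 0" for h
      by (metis inner_diff_right diff_self)
    then show ?thesis by (metis inner_eq_zero_iff right_minus_eq)
  qed
  with D show ?thesis unfolding grad_def by blast
qed

text \<open>
  Class \<open>C\<^sup>2\<close>: the gradient exists everywhere and is itself differentiable, with a
  Jacobian matrix (the Hessian of \<open>f\<close>) that depends continuously on the point.
\<close>
definition C2_function :: "(real ^ 'n \<Rightarrow> real) \<Rightarrow> bool" where
  "C2_function f \<longleftrightarrow>
     (\<forall>x. GDERIV f x :> grad f x) \<and>
     (\<exists>H :: real ^ 'n \<Rightarrow> real ^ 'n ^ 'n.
        (\<forall>x. (grad f has_derivative (\<lambda>h. H x *v h)) (at x)) \<and> continuous_on UNIV H)"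

definition unique_global_minimum :: "('a \<Rightarrow> real) \<Rightarrow> 'a \<Rightarrow> bool" where
  "unique_global_minimum f m \<longleftrightarrow>
     (\<forall>x. f m \<le> f x) \<and> (\<forall>y. (\<forall>x. f y \<le> f x) \<longrightarrow> y = m)"

text \<open>
  A solution on \<open>[0, \<infinity>)\<close> of the initial value problem; the derivative at time \<open>0\<close> is
  one-sided, and values at negative times are irrelevant.  On \<^typ>\<open>real ^ 'n\<close> the product
  and the power are element-wise, so \<open>\<xi> t * p t\<close> and \<open>(p t) ^ 2\<close> are the
  Hadamard product and the element-wise square, while the norm is the Euclidean one.
\<close>
definition ikfad_solution ::
  "(real ^ 'n \<Rightarrow> real) \<Rightarrow> real \<Rightarrow> real \<Rightarrow> real \<Rightarrow>
   real ^ 'n \<Rightarrow> real ^ 'n \<Rightarrow> real ^ 'n \<Rightarrow>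
   (real \<Rightarrow> real ^ 'n) \<Rightarrow> (real \<Rightarrow> real ^ 'n) \<Rightarrow> (real \<Rightarrow> real ^ 'n) \<Rightarrow> bool" where
  "ikfad_solution f \<gamma> \<alpha> \<rho> x0 p0 \<xi>0 x p \<xi> \<longleftrightarrow>
     x 0 = x0 \<and> p 0 = p0 \<and> \<xi> 0 = \<xi>0 \<and>
     (\<forall>t\<ge>0.
        (x has_vector_derivative p t) (at t within {0..}) \<and>
        (p has_vector_derivative
           (- grad f (x t) - \<gamma> *\<^sub>R p t - \<xi> t * p t)) (at t within {0..}) \<and>
        (\<xi> has_vector_derivative
           ((1 / \<rho>) *\<^sub>R (p t) ^ 2 - \<alpha> *\<^sub>R \<xi> t)) (at t within {0..}))"

end

theory Submission
  imports Defs
begin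

text \<open>
  The energy \<open>H = f x - f xstar + \<parallel>p\<parallel>\<^sup>2 / 2 + \<rho> \<parallel>\<xi>\<parallel>\<^sup>2 / 2\<close> satisfies
  \<open>H' = - \<gamma> \<parallel>p\<parallel>\<^sup>2 - \<alpha> \<rho> \<parallel>\<xi>\<parallel>\<^sup>2\<close>, since the cubic terms cancel, and its sublevel sets are
  bounded because the hypothesis on \<open>f\<close> implies quadratic growth around \<open>xstar\<close>.
  Multiplying the vector field by a cutoff function makes it globally Lipschitz without destroying
  this dissipation, so the solution of the truncated system never meets the region where the cutoff
  acts; this gives a global solution.  Exponential decay follows from the Lyapunov
  function \<open>H + \<epsilon> (x - xstar) \<bullet> p\<close> with small \<open>\<epsilon>\<close>.
\<close>

section \<open>Differential inequalities and Lipschitz differential equations on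
  \<open>{0..}\<close>\<close>

text \<open>The integrating factor \<open>exp (- k * t)\<close> reduces the claim to monotonicity of
  \<open>g\<close>. The sign of \<open>k\<close> is free: zero serves the monotone energy,
  \<open>2 * L\<close> uniqueness, and a negative value the final decay.\<close>

lemma exp_gronwall:
  fixes h h' :: "real \<Rightarrow> real"
  assumes deriv: "\<And>t. t \<ge> 0 \<Longrightarrow> (h has_real_derivative h' t) (at t within {0..})"
    and le: "\<And>t. t \<ge> 0 \<Longrightarrow> h' t \<le> k * h t"
    and "t \<ge> 0"
  shows "h t \<le> h 0 * exp (k * t)"
proof -
  define g where "g = (\<lambda>t. h t * exp (- k * t))"
  have d: "(g has_real_derivative (h' s - k * h s) * exp (- k * s)) (at s within {0..})"
    if "s \<ge> 0" for s
    unfolding g_def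
    by (rule derivative_eq_intros deriv that refl)+ (simp add: algebra_simps)
  have "g t \<le> g 0"
  proof (cases "t = 0")
    case False
    with \<open>t \<ge> 0\<close> have "0 < t" by simp
    have "continuous_on {0..} g"
      by (auto simp: continuous_on_eq_continuous_within intro: d DERIV_continuous)
    then have "continuous_on {0..t} g"
      by (rule continuous_on_subset) auto
    moreover have "\<exists>y. (g has_real_derivative y) (at s) \<and> y \<le> 0" if "0 < s" "s < t" for s
    proof -
      have "at s within {0..} = at s"
        using \<open>0 < s\<close> by (intro at_within_interior) simp
      then have "(g has_real_derivative (h' s - k * h s) * exp (- k * s)) (at s)"
        using d[of s] that by simp
      moreover have "(h' s - k * h s) * exp (- k * s) \<le> 0"
        using le[of s] that by (simp add: mult_nonpos_nonneg)
      ultimately show ?thesis by blast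
    qed
    ultimately show ?thesis
      using DERIV_nonpos_imp_decreasing_open[of 0 t g] \<open>0 < t\<close> by auto
  qed simp
  then show ?thesis
    by (simp add: g_def exp_minus field_simps)
qed

text \<open>
  Picard iteration on all of \<open>[0, \<infinity>)\<close> at once: in the Bielecki norm \<open>sup exp (- \<mu> t) \<parallel>z t\<parallel>\<close>
  the integral operator is a contraction as soon as \<open>\<mu>\<close> exceeds the Lipschitz constant.
\<close>

lemma picard_global:
  fixes F :: "'e::banach \<Rightarrow> 'e"
  assumes lip: "L-lipschitz_on UNIV F" and bdd: "bounded (range F)"
  obtains z where "z 0 = z0"
    "\<And>t. t \<ge> 0 \<Longrightarrow> (z has_vector_derivative F (z t)) (at t within {0..})"
proof -
  obtain M where M: "\<And>y. norm (F y) \<le> M"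
    using bdd by (auto simp: bounded_iff)
  have "M \<ge> 0" using M[of 0] norm_ge_zero order_trans by blast
  have "L \<ge> 0" using lip by (rule lipschitz_on_nonneg)
  \<comment> \<open>This choice gives \<open>L / \<mu> \<le> 1 / 2\<close>, the contraction factor,
    and also \<open>\<mu> \<ge> 1\<close>, which makes the weight dominate linear growth.\<close>
  define \<mu> where "\<mu> = 2 * (L + 1)"
  have "\<mu> \<ge> 1" using \<open>L \<ge> 0\<close> by (simp add: \<mu>_def)
  have contF: "continuous_on UNIV F"
    using lip by (rule lipschitz_on_continuous_on)
  \<comment> \<open>The unknown is the rescaled curve
    \<open>u t = exp (- \<mu> * t) *\<^sub>R z t\<close>, so the sup norm of \<open>u\<close> is the
    Bielecki norm of \<open>z\<close>. Bounded continuous functions live on the whole line, hence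
    the constant extension through \<open>max 0 t\<close> in \<open>\<Phi>\<close>.\<close>
  define I where "I = (\<lambda>(u :: real \<Rightarrow>\<^sub>C 'e) t. integral {0..t} (\<lambda>s. F (exp (\<mu> * s) *\<^sub>R u s)))"
  define \<Phi> where "\<Phi> = (\<lambda>(u :: real \<Rightarrow>\<^sub>C 'e) t. exp (- \<mu> * max 0 t) *\<^sub>R (z0 + I u (max 0 t)))"
  have cont: "continuous_on S (\<lambda>s. F (exp (\<mu> * s) *\<^sub>R apply_bcontfun u s))" for u S
    by (rule continuous_on_compose2[OF contF]) (auto intro!: continuous_intros)
  have int: "(\<lambda>s. F (exp (\<mu> * s) *\<^sub>R apply_bcontfun u s)) integrable_on {0..t}" for u t
    by (rule integrable_continuous_real[OF cont])
  have dI: "(I u has_vector_derivative F (exp (\<mu> * t) *\<^sub>R u t)) (at t within {0..})"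
    if "t \<ge> 0" for u t
  proof -
    \<comment> \<open>Integrating up to \<open>t + 1\<close> keeps \<open>t\<close> away from the
      right end, where the derivative would be one-sided.\<close>
    have "(I u has_vector_derivative F (exp (\<mu> * t) *\<^sub>R u t)) (at t within {0..t + 1})"
      unfolding I_def using that by (intro integral_has_vector_derivative[OF cont]) auto
    moreover have "at t within {0..t + 1} = at t within {0..}"
      by (rule at_within_nhd[of _ "{..<t + 1}"]) auto
    ultimately show ?thesis by simp
  qed
  have contI: "continuous_on {0..} (I u)" for u
    by (auto simp: continuous_on_eq_continuous_within
        intro: dI has_vector_derivative_continuous)
  have cont\<Phi>: "continuous_on UNIV (\<Phi> u)" for u
    unfolding \<Phi>_def
    by (intro continuous_intros continuous_on_compose2[OF contI[of u]]) auto
  have normI: "norm (I u t) \<le> M * t" if "t \<ge> 0" for u t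
    unfolding I_def
    using integral_norm_bound_integral[OF int[of u t] integrable_const_ivl[of M]] M that
    by (simp add: mult.commute)
  have bdd\<Phi>: "norm (\<Phi> u t) \<le> norm z0 + M" for u t
  proof -
    define s where "s = max 0 t"
    have "s \<ge> 0" by (simp add: s_def)
    then have "s \<le> \<mu> * s"
      using \<open>\<mu> \<ge> 1\<close> by (simp add: mult_le_cancel_right1)
    then have "s \<le> exp (\<mu> * s)"
      using exp_ge_add_one_self[of "\<mu> * s"] by linarith
    \<comment> \<open>\<open>I u\<close> grows at most linearly since \<open>F\<close> is bounded by
      \<open>M\<close>; the weight absorbs this, so \<open>\<Phi> u\<close> is bounded.\<close>
    then have "exp (- \<mu> * s) * s \<le> 1"
      by (simp add: exp_minus field_simps)
    then have 1: "exp (- \<mu> * s) * (M * s) \<le> M"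
      using mult_left_mono[of "exp (- \<mu> * s) * s" 1 M] \<open>M \<ge> 0\<close> by (simp add: mult_ac)
    have 2: "exp (- \<mu> * s) * norm z0 \<le> norm z0"
      using \<open>s \<ge> 0\<close> \<open>\<mu> \<ge> 1\<close> by (intro mult_left_le_one_le) auto
    have "norm (\<Phi> u t) \<le> exp (- \<mu> * s) * (norm z0 + M * s)"
      unfolding \<Phi>_def s_def[symmetric]
      using norm_triangle_ineq[of z0 "I u s"] normI[OF \<open>s \<ge> 0\<close>, of u] by simp
    with 1 2 show ?thesis by (simp add: distrib_left)
  qed
  define \<Psi> where "\<Psi> = (\<lambda>u. Bcontfun (\<Phi> u))"
  have \<Psi>: "apply_bcontfun (\<Psi> u) = \<Phi> u" for u
    unfolding \<Psi>_def by (intro Bcontfun_inverse bcontfun_normI[OF cont\<Phi> bdd\<Phi>])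
  have "dist (\<Psi> u) (\<Psi> v) \<le> 1 / 2 * dist u v" for u v
  proof (rule dist_bound)
    fix t :: real
    define s where "s = max 0 t"
    have "s \<ge> 0" by (simp add: s_def)
    define d where "d = dist u v"
    have "d \<ge> 0" by (simp add: d_def)
    \<comment> \<open>Integrating the Lipschitz bound of the integrands produces the factor
      \<open>L / \<mu>\<close>.\<close>
    have "((\<lambda>r. L * d * exp (\<mu> * r)) has_integral
        L * d / \<mu> * exp (\<mu> * s) - L * d / \<mu> * exp (\<mu> * 0)) {0..s}"
      using \<open>s \<ge> 0\<close> \<open>\<mu> \<ge> 1\<close>
      by (intro fundamental_theorem_of_calculus)
        (auto intro!: derivative_eq_intros
          simp: has_real_derivative_iff_has_vector_derivative[symmetric])
    moreover have "norm (F (exp (\<mu> * r) *\<^sub>R u r) - F (exp (\<mu> * r) *\<^sub>R v r)) \<le> L * d * exp (\<mu> * r)"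
      for r
    proof -
      have "norm (F (exp (\<mu> * r) *\<^sub>R u r) - F (exp (\<mu> * r) *\<^sub>R v r))
          \<le> L * norm (exp (\<mu> * r) *\<^sub>R u r - exp (\<mu> * r) *\<^sub>R v r)"
        using lip by (rule lipschitz_on_normD) auto
      also have "norm (exp (\<mu> * r) *\<^sub>R u r - exp (\<mu> * r) *\<^sub>R v r) = exp (\<mu> * r) * dist (u r) (v r)"
        by (simp add: scaleR_diff_right[symmetric] dist_norm)
      also have "L * (exp (\<mu> * r) * dist (u r) (v r)) \<le> L * (exp (\<mu> * r) * d)"
        unfolding d_def by (intro mult_left_mono dist_bounded) (auto simp: \<open>L \<ge> 0\<close>)
      finally show ?thesis by (simp add: mult_ac)
    qed
    ultimately have "norm (I u s - I v s) \<le> L * d / \<mu> * exp (\<mu> * s) - L * d / \<mu>"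
      unfolding I_def integral_diff[OF int int, symmetric]
      by (intro integral_norm_bound_integral[THEN order_trans] integrable_diff int)
        (auto simp: has_integral_iff)
    also have "\<dots> \<le> L * d / \<mu> * exp (\<mu> * s)"
      using \<open>L \<ge> 0\<close> \<open>d \<ge> 0\<close> \<open>\<mu> \<ge> 1\<close> by simp
    also have "L * d / \<mu> \<le> 1 / 2 * d"
      using \<open>L \<ge> 0\<close> \<open>d \<ge> 0\<close> by (simp add: \<mu>_def field_simps)
    finally have "norm (I u s - I v s) \<le> 1 / 2 * d * exp (\<mu> * s)"
      by simp
    then have "exp (- \<mu> * s) * norm (I u s - I v s) \<le> 1 / 2 * d"
      by (simp add: exp_minus field_simps)
    moreover have "dist (\<Psi> u t) (\<Psi> v t) = exp (- \<mu> * s) * norm (I u s - I v s)"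
      by (simp add: \<Psi> \<Phi>_def s_def[symmetric] dist_norm scaleR_diff_right[symmetric])
    ultimately show "dist (\<Psi> u t) (\<Psi> v t) \<le> 1 / 2 * dist u v"
      by (simp add: d_def)
  qed
  then obtain u where u: "\<Psi> u = u"
    using banach_fix_type[of "1 / 2" \<Psi>] by auto
  define z where "z = (\<lambda>t. exp (\<mu> * t) *\<^sub>R apply_bcontfun u t)"
  have z: "z t = z0 + I u t" if "t \<ge> 0" for t
    using fun_cong[OF \<Psi>[of u], of t] that unfolding u
    by (simp add: z_def \<Phi>_def exp_minus field_simps)
  show thesis
  proof
    show "z 0 = z0" using z[of 0] by (simp add: I_def)
    show "(z has_vector_derivative F (z t)) (at t within {0..})" if "t \<ge> 0" for t
    proof (rule has_vector_derivative_transform)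
      show "((\<lambda>t. z0 + I u t) has_vector_derivative F (z t)) (at t within {0..})"
        using dI[OF that, of u] by (auto simp: z_def intro!: derivative_eq_intros)
    qed (use that z in auto)
  qed
qed

text \<open>The squared distance \<open>h\<close> satisfies \<open>h' \<le> 2 * L * h\<close> by
  Cauchy-Schwarz and vanishes at time 0. A Lipschitz bound on a set containing both curves suffices,
  which suits a field that is only locally Lipschitz.\<close>

lemma lipschitz_ode_unique:
  fixes F :: "'e::real_inner \<Rightarrow> 'e"
  assumes lip: "L-lipschitz_on S F" and S: "\<And>t. t \<ge> 0 \<Longrightarrow> y t \<in> S \<and> z t \<in> S"
    and dy: "\<And>t. t \<ge> 0 \<Longrightarrow> (y has_vector_derivative F (y t)) (at t within {0..})"
    and dz: "\<And>t. t \<ge> 0 \<Longrightarrow> (z has_vector_derivative F (z t)) (at t within {0..})"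
    and "y 0 = z 0" and "t \<ge> 0"
  shows "y t = z t"
proof -
  define h where "h = (\<lambda>t. (y t - z t) \<bullet> (y t - z t))"
  have "(h has_real_derivative 2 * ((y s - z s) \<bullet> (F (y s) - F (z s)))) (at s within {0..})"
    if "s \<ge> 0" for s
    unfolding h_def has_real_derivative_iff_has_vector_derivative
    using bounded_bilinear.has_vector_derivative[OF bounded_bilinear_inner
        has_vector_derivative_diff[OF dy dz] has_vector_derivative_diff[OF dy dz], OF that that that that]
    by (simp add: inner_commute)
  moreover have "2 * ((y s - z s) \<bullet> (F (y s) - F (z s))) \<le> 2 * L * h s" if "s \<ge> 0" for s
  proof -
    have "(y s - z s) \<bullet> (F (y s) - F (z s)) \<le> norm (y s - z s) * norm (F (y s) - F (z s))"
      by (rule norm_cauchy_schwarz)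
    also have "\<dots> \<le> norm (y s - z s) * (L * norm (y s - z s))"
      using S[OF that] lip by (intro mult_left_mono lipschitz_on_normD[of L S F]) auto
    finally show ?thesis
      by (simp add: h_def dot_square_norm power2_eq_square mult_ac)
  qed
  ultimately have "h t \<le> h 0 * exp (2 * L * t)"
    using \<open>t \<ge> 0\<close> by (rule exp_gronwall)
  then show ?thesis
    using \<open>y 0 = z 0\<close> by (simp add: h_def dot_square_norm)
qed

section \<open>Truncation and Lipschitz estimates\<close>

text \<open>The cutoff \<open>\<phi>\<close> is 1-Lipschitz, equals 1 on the ball of radius
  \<open>R\<close> and vanishes outside radius \<open>R + 1\<close>, so it multiplies
  \<open>G\<close> only where \<open>G\<close> is bounded and Lipschitz.\<close>

lemma lipschitz_cutoff:
  fixes G :: "'e::real_normed_vector \<Rightarrow> 'f::real_normed_vector"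
  assumes lip: "L-lipschitz_on (cball 0 (R + 1)) G" and "R \<ge> 0"
  defines "\<phi> \<equiv> \<lambda>z. max 0 (min 1 (R + 1 - norm z))"
  obtains K where "K-lipschitz_on UNIV (\<lambda>z. \<phi> z *\<^sub>R G z)" "bounded (range (\<lambda>z. \<phi> z *\<^sub>R G z))"
proof -
  have "L \<ge> 0" using lip by (rule lipschitz_on_nonneg)
  define M where "M = norm (G 0) + L * (R + 1)"
  have "M \<ge> 0" using \<open>L \<ge> 0\<close> \<open>R \<ge> 0\<close> by (simp add: M_def)
  have M: "norm (G z) \<le> M" if "norm z \<le> R + 1" for z
  proof -
    have "norm (G z - G 0) \<le> L * norm (z - 0)"
      using that \<open>R \<ge> 0\<close> by (intro lipschitz_on_normD[OF lip]) auto
    also have "\<dots> \<le> L * (R + 1)"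
      using that \<open>L \<ge> 0\<close> by (intro mult_left_mono) auto
    finally show ?thesis
      using norm_triangle_sub[of "G z" "G 0"] by (simp add: M_def)
  qed
  have \<phi>01: "0 \<le> \<phi> z" "\<phi> z \<le> 1" for z by (auto simp: \<phi>_def)
  have \<phi>0: "\<phi> z = 0" if "\<not> norm z \<le> R + 1" for z using that by (auto simp: \<phi>_def)
  have \<phi>lip: "\<bar>\<phi> z - \<phi> w\<bar> \<le> norm (z - w)" for z w
    using norm_triangle_ineq3[of z w] by (auto simp: \<phi>_def max_def min_def)
  \<comment> \<open>Only \<open>z\<close> need lie in the ball: for \<open>w\<close> outside,
    \<open>\<phi> w = 0\<close> and the variation of \<open>\<phi>\<close> alone gives the bound.
    The opposite case follows by exchanging the points.\<close>
  have in_ball: "norm (\<phi> z *\<^sub>R G z - \<phi> w *\<^sub>R G w) \<le> (M + L) * norm (z - w)"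
    if "norm z \<le> R + 1" for z w
  proof (cases "norm w \<le> R + 1")
    case True
    have "\<phi> z *\<^sub>R G z - \<phi> w *\<^sub>R G w = (\<phi> z - \<phi> w) *\<^sub>R G z + \<phi> w *\<^sub>R (G z - G w)"
      by (simp add: algebra_simps)
    also have "norm \<dots> \<le> \<bar>\<phi> z - \<phi> w\<bar> * norm (G z) + \<phi> w * norm (G z - G w)"
      by (rule norm_triangle_le) (simp add: \<phi>01)
    also have "\<dots> \<le> norm (z - w) * M + 1 * (L * norm (z - w))"
      using that True \<phi>lip M \<phi>01
      by (intro add_mono mult_mono lipschitz_on_normD[OF lip]) auto
    finally show ?thesis by (simp add: algebra_simps)
  next
    case False
    then have "norm (\<phi> z *\<^sub>R G z - \<phi> w *\<^sub>R G w) = \<bar>\<phi> z - \<phi> w\<bar> * norm (G z)"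
      by (simp add: \<phi>0)
    also have "\<dots> \<le> norm (z - w) * M"
      using that \<phi>lip M by (intro mult_mono) auto
    also have "\<dots> \<le> (M + L) * norm (z - w)"
      using \<open>L \<ge> 0\<close> by (simp add: algebra_simps)
    finally show ?thesis .
  qed
  show thesis
  proof
    show "(M + L)-lipschitz_on UNIV (\<lambda>z. \<phi> z *\<^sub>R G z)"
    proof (rule lipschitz_onI)
      fix z w
      show "dist (\<phi> z *\<^sub>R G z) (\<phi> w *\<^sub>R G w) \<le> (M + L) * dist z w"
      proof (cases "norm z \<le> R + 1 \<or> norm w \<le> R + 1")
        case True
        then show ?thesis
          using in_ball[of z w] in_ball[of w z] by (auto simp: dist_norm norm_minus_commute)
      next
        case False
        then show ?thesis
          using \<open>M \<ge> 0\<close> \<open>L \<ge> 0\<close> by (simp add: \<phi>0)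
      qed
    qed (use \<open>M \<ge> 0\<close> \<open>L \<ge> 0\<close> in simp)
    have "norm (\<phi> z *\<^sub>R G z) \<le> M" for z
    proof (cases "norm z \<le> R + 1")
      case True
      have "\<phi> z * norm (G z) \<le> 1 * M"
        using \<phi>01 M[OF True] by (intro mult_mono) auto
      then show ?thesis by (simp add: \<phi>01)
    qed (simp add: \<phi>0 \<open>M \<ge> 0\<close>)
    then show "bounded (range (\<lambda>z. \<phi> z *\<^sub>R G z))"
      by (auto simp: bounded_iff)
  qed
qed

lemma norm_hadamard_le: "norm (a * b) \<le> norm a * norm b" for a b :: "real ^ 'n"
proof -
  have "norm (a * b) \<le> norm (norm a *\<^sub>R b)"
    by (rule norm_le_componentwise_cart)
      (auto simp: abs_mult intro: mult_right_mono component_le_norm_cart)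
  then show ?thesis by simp
qed

text \<open>Cauchy-Schwarz in each row; the norm of a matrix, as a vector of rows, is the Frobenius
  norm.\<close>

lemma norm_matrix_vector_mult_le: "norm (A *v x) \<le> norm A * norm x"
  for A :: "real ^ 'n ^ 'm"
proof -
  have "norm ((A *v x) $ i) \<le> norm ((\<chi> i. norm x * norm (A $ i)) $ i)" for i
    using Cauchy_Schwarz_ineq2[of "A $ i" x]
    by (simp add: matrix_vector_mul_component mult.commute)
  then have "norm (A *v x) \<le> norm (\<chi> i. norm x * norm (A $ i))"
    by (rule norm_le_componentwise_cart)
  also have "(\<chi> i. norm x * norm (A $ i)) = norm x *\<^sub>R (\<chi> i. norm (A $ i))"
    by (simp add: vec_eq_iff)
  also have "norm \<dots> = norm x * norm (\<chi> i. norm (A $ i))"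
    by simp
  also have "norm (\<chi> i. norm (A $ i)) = norm A"
    by (simp add: norm_vec_def)
  finally show ?thesis by (simp add: mult.commute)
qed

text \<open>The continuous Hessian is bounded on the compact ball, and the mean value inequality
  applies because the ball is convex.\<close>

lemma C2_function_grad_lipschitz:
  fixes f :: "real ^ 'n \<Rightarrow> real"
  assumes "C2_function f"
  obtains L where "L-lipschitz_on (cball 0 R) (grad f)"
proof -
  obtain H :: "real ^ 'n \<Rightarrow> real ^ 'n ^ 'n" where
    H: "\<And>x. (grad f has_derivative (\<lambda>h. H x *v h)) (at x)" and cont: "continuous_on UNIV H"
    using assms by (auto simp: C2_function_def)
  have "compact (H ` cball 0 R)"
    using cont by (intro compact_continuous_image) (auto intro: continuous_on_subset)
  then obtain B where B: "\<And>x. x \<in> cball 0 R \<Longrightarrow> norm (H x) \<le> B" and "B > 0"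
    using compact_imp_bounded[of "H ` cball 0 R"] by (fastforce simp: bounded_pos)
  have on: "onorm (\<lambda>h. H x *v h) \<le> B" if "x \<in> cball 0 R" for x
  proof (rule onorm_le)
    fix h
    have "norm (H x *v h) \<le> norm (H x) * norm h"
      by (rule norm_matrix_vector_mult_le)
    also have "\<dots> \<le> B * norm h"
      using B[OF that] by (rule mult_right_mono) simp
    finally show "norm (H x *v h) \<le> B * norm h" .
  qed
  have "B-lipschitz_on (cball 0 R) (grad f)"
    using \<open>B > 0\<close>
    by (intro lipschitz_onI)
      (auto simp: dist_norm
        intro!: differentiable_bound[of "cball 0 R" "grad f" "\<lambda>x h. H x *v h" B]
          on has_derivative_at_withinI H)
  then show thesis by (rule that)
qed

lemma lipschitz_on_hadamard:
  fixes g h :: "'e::metric_space \<Rightarrow> real ^ 'n"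
  assumes g: "L-lipschitz_on S g" and h: "M-lipschitz_on S h"
    and A: "\<And>z. z \<in> S \<Longrightarrow> norm (g z) \<le> A" and B: "\<And>z. z \<in> S \<Longrightarrow> norm (h z) \<le> B"
    and "A \<ge> 0" and "B \<ge> 0"
  shows "(A * M + L * B)-lipschitz_on S (\<lambda>z. g z * h z)"
proof (rule lipschitz_onI)
  have "L \<ge> 0" "M \<ge> 0" using g h by (auto dest: lipschitz_on_nonneg)
  then show "A * M + L * B \<ge> 0" using \<open>A \<ge> 0\<close> \<open>B \<ge> 0\<close> by simp
  fix z w assume "z \<in> S" "w \<in> S"
  have "dist (g z * h z) (g w * h w) = norm (g z * (h z - h w) + (g z - g w) * h w)"
    by (simp add: dist_norm algebra_simps)
  also have "\<dots> \<le> norm (g z) * norm (h z - h w) + norm (g z - g w) * norm (h w)"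
    by (intro norm_triangle_le add_mono norm_hadamard_le)
  also have "\<dots> \<le> A * (M * dist z w) + (L * dist z w) * B"
    using lipschitz_onD[OF g \<open>z \<in> S\<close> \<open>w \<in> S\<close>] lipschitz_onD[OF h \<open>z \<in> S\<close> \<open>w \<in> S\<close>]
      A[OF \<open>z \<in> S\<close>] B[OF \<open>w \<in> S\<close>] \<open>A \<ge> 0\<close> \<open>L \<ge> 0\<close>
    by (intro add_mono mult_mono) (auto simp: dist_norm)
  finally show "dist (g z * h z) (g w * h w) \<le> (A * M + L * B) * dist z w"
    by (simp add: algebra_simps)
qed

section \<open>Derivatives along curves\<close>

lemma has_vector_derivative_Pair_iff:
  "((\<lambda>t. (u t, v t)) has_vector_derivative (u', v')) (at t within S) \<longleftrightarrow>
    (u has_vector_derivative u') (at t within S) \<and> (v has_vector_derivative v') (at t within S)"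
proof
  assume *: "((\<lambda>t. (u t, v t)) has_vector_derivative (u', v')) (at t within S)"
  show "(u has_vector_derivative u') (at t within S) \<and> (v has_vector_derivative v') (at t within S)"
    using bounded_linear.has_vector_derivative[OF bounded_linear_fst *]
      bounded_linear.has_vector_derivative[OF bounded_linear_snd *] by simp
qed (simp add: has_vector_derivative_Pair)

lemma has_real_derivative_inner:
  assumes "(u has_vector_derivative u') (at t within S)"
    and "(v has_vector_derivative v') (at t within S)"
  shows "((\<lambda>t. u t \<bullet> v t) has_real_derivative (u t \<bullet> v' + u' \<bullet> v t)) (at t within S)"
  unfolding has_real_derivative_iff_has_vector_derivative
  by (rule bounded_bilinear.has_vector_derivative[OF bounded_bilinear_inner assms])

lemma GDERIV_has_real_derivative:
  assumes "GDERIV f (x t) :> D" and "(x has_vector_derivative v) (at t within S)"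
  shows "((\<lambda>s. f (x s)) has_real_derivative v \<bullet> D) (at t within S)"
  using has_derivative_compose[OF assms(2)[unfolded has_vector_derivative_def]
      assms(1)[unfolded gderiv_def]]
  by (simp add: has_field_derivative_def mult_commute_abs)

section \<open>The system as one vector field on phase space, and its energy\<close>

definition ikfad_field ::
  "(real ^ 'n \<Rightarrow> real) \<Rightarrow> real \<Rightarrow> real \<Rightarrow> real \<Rightarrow>
   (real ^ 'n) \<times> (real ^ 'n) \<times> (real ^ 'n) \<Rightarrow> (real ^ 'n) \<times> (real ^ 'n) \<times> (real ^ 'n)" where
  "ikfad_field f \<gamma> \<alpha> \<rho> = (\<lambda>(x, p, \<xi>).
     (p, - grad f x - \<gamma> *\<^sub>R p - \<xi> * p, (1 / \<rho>) *\<^sub>R p ^ 2 - \<alpha> *\<^sub>R \<xi>))"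

lemma ikfad_solution_iff:
  "ikfad_solution f \<gamma> \<alpha> \<rho> x0 p0 \<xi>0 x p \<xi> \<longleftrightarrow>
     (x 0, p 0, \<xi> 0) = (x0, p0, \<xi>0) \<and>
     (\<forall>t\<ge>0. ((\<lambda>t. (x t, p t, \<xi> t)) has_vector_derivative
        ikfad_field f \<gamma> \<alpha> \<rho> (x t, p t, \<xi> t)) (at t within {0..}))"
  by (auto simp: ikfad_solution_def ikfad_field_def has_vector_derivative_Pair_iff)

text \<open>All components are bounded on the ball, so the quadratic terms are Lipschitz there; the
  bound is then assembled coordinate by coordinate.\<close>

lemma ikfad_field_lipschitz:
  fixes f :: "real ^ 'n \<Rightarrow> real"
  assumes "C2_function f"
  obtains L where "L-lipschitz_on (cball 0 R) (ikfad_field f \<gamma> \<alpha> \<rho>)"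
proof -
  define S :: "((real ^ 'n) \<times> (real ^ 'n) \<times> (real ^ 'n)) set" where "S = cball 0 R"
  have x: "norm (fst z) \<le> norm z" and p: "norm (fst (snd z)) \<le> norm z"
    and \<xi>: "norm (snd (snd z)) \<le> norm z" for z :: "(real ^ 'n) \<times> (real ^ 'n) \<times> (real ^ 'n)"
    using norm_fst_le[of "fst z" "snd z"] norm_snd_le[of "snd z" "fst z"]
      norm_fst_le[of "fst (snd z)" "snd (snd z)"] norm_snd_le[of "snd (snd z)" "fst (snd z)"]
    by auto
  have lipx: "1-lipschitz_on S fst" and lipp: "1-lipschitz_on S (\<lambda>z. fst (snd z))"
    and lip\<xi>: "1-lipschitz_on S (\<lambda>z. snd (snd z))"
    using x[of "z - w" for z w] p[of "z - w" for z w] \<xi>[of "z - w" for z w]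
    by (auto intro!: lipschitz_onI simp: dist_norm)
  have bx: "norm (fst z) \<le> R" if "z \<in> S" for z
    using that x[of z] by (auto simp: S_def)
  \<comment> \<open>\<open>R\<close> may be negative, while the estimate for Hadamard products asks
    for nonnegative bounds.\<close>
  have bp: "norm (fst (snd z)) \<le> max 0 R" and b\<xi>: "norm (snd (snd z)) \<le> max 0 R" if "z \<in> S" for z
    using that p[of z] \<xi>[of z] by (auto simp: S_def)
  obtain L where "L-lipschitz_on (cball 0 R) (grad f)"
    using C2_function_grad_lipschitz[OF assms] .
  moreover have "fst ` S \<subseteq> cball 0 R"
    using bx by (simp add: image_subset_iff)
  ultimately have "L-lipschitz_on (fst ` S) (grad f)"
    by (rule lipschitz_on_subset)
  from lipschitz_on_compose2[OF lipx this]
  have g: "(L * 1)-lipschitz_on S (\<lambda>z. grad f (fst z))" by simp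
  have h1: "(max 0 R * 1 + 1 * max 0 R)-lipschitz_on S (\<lambda>z. snd (snd z) * fst (snd z))"
    by (rule lipschitz_on_hadamard[OF lip\<xi> lipp]) (use b\<xi> bp in auto)
  have h2: "(max 0 R * 1 + 1 * max 0 R)-lipschitz_on S (\<lambda>z. fst (snd z) * fst (snd z))"
    by (rule lipschitz_on_hadamard[OF lipp lipp]) (use bp in auto)
  note lipschitz_on_Pair[OF lipp lipschitz_on_Pair[OF
      lipschitz_on_diff[OF lipschitz_on_diff[OF
          lipschitz_on_minus[OF g] lipschitz_on_cmult[OF lipp, of \<gamma>]] h1]
      lipschitz_on_diff[OF
        lipschitz_on_cmult[OF h2, of "1 / \<rho>"] lipschitz_on_cmult[OF lip\<xi>, of \<alpha>]]]]
  then show thesis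
    using that by (auto simp: S_def ikfad_field_def case_prod_unfold power2_eq_square)
qed

text \<open>The weight \<open>\<rho> / 2\<close> compensates the factor \<open>1 / \<rho>\<close> in
  the equation for \<open>\<xi>\<close>; \<open>m\<close> stands for the minimum value of
  \<open>f\<close>.\<close>

definition ikfad_energy ::
  "(real ^ 'n \<Rightarrow> real) \<Rightarrow> real \<Rightarrow> real \<Rightarrow> (real ^ 'n) \<times> (real ^ 'n) \<times> (real ^ 'n) \<Rightarrow> real" where
  "ikfad_energy f m \<rho> = (\<lambda>(x, p, \<xi>). f x - m + (norm p)\<^sup>2 / 2 + \<rho> / 2 * (norm \<xi>)\<^sup>2)"

lemma inner_hadamard_power2: "p \<bullet> (\<xi> * p) = \<xi> \<bullet> p ^ 2" for p \<xi> :: "real ^ 'n"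
  by (simp add: inner_vec_def power2_eq_square mult_ac)

text \<open>The terms \<open>p \<bullet> grad f x\<close> cancel between potential and kinetic
  energy, and the terms \<open>\<xi> \<bullet> p ^ 2\<close> between the equations for
  \<open>p\<close> and \<open>\<xi>\<close>. Only friction and the damping of \<open>\<xi>\<close>
  remain.\<close>

lemma ikfad_energy_derivative:
  assumes f: "GDERIV f (x t) :> grad f (x t)" and "\<rho> \<noteq> 0"
    and d: "((\<lambda>t. (x t, p t, \<xi> t)) has_vector_derivative
        c *\<^sub>R ikfad_field f \<gamma> \<alpha> \<rho> (x t, p t, \<xi> t)) (at t within S)"
  shows "((\<lambda>t. ikfad_energy f m \<rho> (x t, p t, \<xi> t)) has_real_derivative
      - c * (\<gamma> * (norm (p t))\<^sup>2 + \<alpha> * \<rho> * (norm (\<xi> t))\<^sup>2)) (at t within S)"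
proof -
  define p' \<xi>' where "p' = c *\<^sub>R (- grad f (x t) - \<gamma> *\<^sub>R p t - \<xi> t * p t)"
    and "\<xi>' = c *\<^sub>R ((1 / \<rho>) *\<^sub>R (p t) ^ 2 - \<alpha> *\<^sub>R \<xi> t)"
  have dx: "(x has_vector_derivative c *\<^sub>R p t) (at t within S)"
    and dp: "(p has_vector_derivative p') (at t within S)"
    and d\<xi>: "(\<xi> has_vector_derivative \<xi>') (at t within S)"
    using d by (auto simp: ikfad_field_def has_vector_derivative_Pair_iff p'_def \<xi>'_def)
  have p': "p t \<bullet> p' = c * (- (p t \<bullet> grad f (x t)) - \<gamma> * (p t \<bullet> p t) - \<xi> t \<bullet> (p t) ^ 2)"
    by (simp add: p'_def inner_diff_right inner_hadamard_power2)
  have \<xi>': "\<xi> t \<bullet> \<xi>' = c * (\<xi> t \<bullet> (p t) ^ 2 / \<rho> - \<alpha> * (\<xi> t \<bullet> \<xi> t))"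
    by (simp add: \<xi>'_def inner_diff_right)
  have "((\<lambda>t. f (x t) - m + 1 / 2 * (p t \<bullet> p t) + \<rho> / 2 * (\<xi> t \<bullet> \<xi> t)) has_real_derivative
      c *\<^sub>R p t \<bullet> grad f (x t) - 0 + 1 / 2 * (p t \<bullet> p' + p' \<bullet> p t)
      + \<rho> / 2 * (\<xi> t \<bullet> \<xi>' + \<xi>' \<bullet> \<xi> t)) (at t within S)"
    by (intro DERIV_add DERIV_diff DERIV_const DERIV_cmult GDERIV_has_real_derivative[OF f dx]
        has_real_derivative_inner dp d\<xi>)
  also have "c *\<^sub>R p t \<bullet> grad f (x t) - 0 + 1 / 2 * (p t \<bullet> p' + p' \<bullet> p t)
      + \<rho> / 2 * (\<xi> t \<bullet> \<xi>' + \<xi>' \<bullet> \<xi> t)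
      = - c * (\<gamma> * (p t \<bullet> p t) + \<alpha> * \<rho> * (\<xi> t \<bullet> \<xi> t))"
    using \<open>\<rho> \<noteq> 0\<close>
    by (simp add: inner_commute[of p' "p t"] inner_commute[of \<xi>' "\<xi> t"] p' \<xi>' field_simps)
  finally show ?thesis
    by (simp add: ikfad_energy_def power2_norm_eq_inner)
qed

section \<open>Coercivity and dissipation of the energy\<close>

locale ikfad =
  fixes f :: "real ^ 'n \<Rightarrow> real" and xstar :: "real ^ 'n" and a b \<gamma> \<alpha> \<rho> :: real
  assumes C2: "C2_function f"
    and min: "unique_global_minimum f xstar"
    and a: "a > 0" and b: "b > 0"
    and strong: "\<And>x. a * (f x - f xstar) + b * (norm (x - xstar))\<^sup>2
              \<le> (x - xstar) \<bullet> (grad f x - grad f xstar)"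
    and \<gamma>: "\<gamma> > 0" and \<alpha>: "\<alpha> > 0" and \<rho>: "\<rho> > 0"
begin

abbreviation "field \<equiv> ikfad_field f \<gamma> \<alpha> \<rho>"
abbreviation "energy \<equiv> ikfad_energy f (f xstar) \<rho>"

lemma GDERIV_grad: "GDERIV f x :> grad f x"
  using C2 by (simp add: C2_function_def)

lemma f_ge: "f xstar \<le> f x"
  using min by (simp add: unique_global_minimum_def)

lemma grad_xstar: "grad f xstar = 0"
proof -
  have "(\<lambda>h. h \<bullet> grad f xstar) = (\<lambda>h. 0)"
    using GDERIV_grad[of xstar] f_ge unfolding gderiv_def
    by (intro differential_zero_maxmin[of xstar UNIV f]) auto
  then have "grad f xstar \<bullet> grad f xstar = 0" by metis
  then show ?thesis by simp
qed

text \<open>Along the segment from \<open>xstar\<close> to \<open>x\<close> the hypothesis bounds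
  the slope of \<open>f\<close> below by \<open>b * (norm v)\<^sup>2 * s\<close>; integration over
  \<open>s\<close> from 0 to 1 gives the factor \<open>b / 2\<close>.\<close>

lemma f_quadratic_growth: "b / 2 * (norm (x - xstar))\<^sup>2 \<le> f x - f xstar"
proof -
  define v where "v = x - xstar"
  \<comment> \<open>Subtracting the expected parabola turns the integration into monotonicity of
    \<open>g\<close>.\<close>
  define g where "g = (\<lambda>s. f (xstar + s *\<^sub>R v) - b / 2 * (norm v)\<^sup>2 * s\<^sup>2)"
  have dg: "(g has_real_derivative v \<bullet> grad f (xstar + s *\<^sub>R v) - b * (norm v)\<^sup>2 * s) (at s)" for s
    unfolding g_def
    by (rule derivative_eq_intros GDERIV_has_real_derivative[OF GDERIV_grad] refl)+ auto
  have "g 0 \<le> g 1"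
  proof (rule DERIV_nonneg_imp_increasing_open[of 0 1 g])
    fix s :: real assume "0 < s"
    have "b * (norm (s *\<^sub>R v))\<^sup>2 \<le> s *\<^sub>R v \<bullet> grad f (xstar + s *\<^sub>R v)"
    proof -
      have "0 \<le> a * (f (xstar + s *\<^sub>R v) - f xstar)"
        using a f_ge by (intro mult_nonneg_nonneg) auto
      with strong[of "xstar + s *\<^sub>R v"] show ?thesis
        unfolding grad_xstar by simp
    qed
    then have "s * (b * (norm v)\<^sup>2 * s) \<le> s * (v \<bullet> grad f (xstar + s *\<^sub>R v))"
      by (simp add: power_mult_distrib power2_eq_square mult_ac)
    then have "0 \<le> v \<bullet> grad f (xstar + s *\<^sub>R v) - b * (norm v)\<^sup>2 * s"
      using \<open>0 < s\<close> by simp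
    with dg show "\<exists>y. (g has_real_derivative y) (at s) \<and> 0 \<le> y" by blast
  next
    show "continuous_on {0..1} g"
      using dg by (intro continuous_at_imp_continuous_on) (auto intro: DERIV_isCont)
  qed simp
  then show ?thesis
    by (simp add: g_def v_def)
qed

lemma energy_bounds:
  fixes x p \<xi> :: "real ^ 'n"
  shows "f x - f xstar \<le> energy (x, p, \<xi>)"
    and "b / 2 * (norm (x - xstar))\<^sup>2 \<le> energy (x, p, \<xi>)"
    and "(norm p)\<^sup>2 \<le> 2 * energy (x, p, \<xi>)"
    and "(norm \<xi>)\<^sup>2 \<le> 2 / \<rho> * energy (x, p, \<xi>)"
    and "0 \<le> energy (x, p, \<xi>)"
proof -
  have e: "0 \<le> \<rho> / 2 * (norm \<xi>)\<^sup>2" "0 \<le> (norm p)\<^sup>2 / 2" "0 \<le> f x - f xstar"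
    using \<rho> f_ge by auto
  have H: "energy (x, p, \<xi>) = f x - f xstar + (norm p)\<^sup>2 / 2 + \<rho> / 2 * (norm \<xi>)\<^sup>2"
    by (simp add: ikfad_energy_def)
  with e show "f x - f xstar \<le> energy (x, p, \<xi>)"
    and "b / 2 * (norm (x - xstar))\<^sup>2 \<le> energy (x, p, \<xi>)"
    and "(norm p)\<^sup>2 \<le> 2 * energy (x, p, \<xi>)"
    and "0 \<le> energy (x, p, \<xi>)"
    using f_quadratic_growth[of x] by linarith+
  have "\<rho> / 2 * (norm \<xi>)\<^sup>2 \<le> energy (x, p, \<xi>)"
    using e H by linarith
  then show "(norm \<xi>)\<^sup>2 \<le> 2 / \<rho> * energy (x, p, \<xi>)"
    using \<rho> by (simp add: field_simps)
qed

lemma sublevel_bounded: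
  obtains R where "R \<ge> 0" "\<And>z. energy z \<le> E \<Longrightarrow> norm z \<le> R"
proof
  \<comment> \<open>One radius for each component. The absolute value keeps the square roots
    nonnegative also when \<open>E < 0\<close> and the sublevel set is empty.\<close>
  define R where
    "R = norm xstar + sqrt (2 / b * \<bar>E\<bar>) + (sqrt (2 * \<bar>E\<bar>) + sqrt (2 / \<rho> * \<bar>E\<bar>))"
  show "R \<ge> 0"
    using b \<rho> by (simp add: R_def)
  fix z assume E: "energy z \<le> E"
  obtain x p \<xi> where z: "z = (x, p, \<xi>)" by (cases z)
  have "E \<ge> 0" using energy_bounds(5)[where x = x and p = p and \<xi> = \<xi>] E by (simp add: z)
  note le = energy_bounds[where x = x and p = p and \<xi> = \<xi>, folded z]
  have "(norm (x - xstar))\<^sup>2 \<le> 2 / b * energy z"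
    using le(2) b by (simp add: field_simps)
  also have "\<dots> \<le> 2 / b * \<bar>E\<bar>"
    using E \<open>E \<ge> 0\<close> b by (intro mult_left_mono) auto
  finally have "norm (x - xstar) \<le> sqrt (2 / b * \<bar>E\<bar>)"
    by (rule real_le_rsqrt)
  then have "norm x \<le> norm xstar + sqrt (2 / b * \<bar>E\<bar>)"
    using norm_triangle_sub[of x xstar] by simp
  moreover have "norm p \<le> sqrt (2 * \<bar>E\<bar>)"
    using le(3) E \<open>E \<ge> 0\<close> by (intro real_le_rsqrt) auto
  moreover have "norm \<xi> \<le> sqrt (2 / \<rho> * \<bar>E\<bar>)"
    using E \<open>E \<ge> 0\<close> \<rho> by (intro real_le_rsqrt order_trans[OF le(4)] mult_left_mono) auto
  ultimately show "norm z \<le> R"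
    using norm_Pair_le[of x "(p, \<xi>)"] norm_Pair_le[of p \<xi>] by (simp add: z R_def)
qed

text \<open>
  The factor \<open>c\<close> admits solutions of the truncated system, whose field is a multiple of the
  original one by a cutoff function: they dissipate the same energy.
\<close>

lemma energy_nonincreasing:
  assumes dz: "\<And>t. t \<ge> 0 \<Longrightarrow> (z has_vector_derivative c t *\<^sub>R field (z t)) (at t within {0..})"
    and c: "\<And>t. t \<ge> 0 \<Longrightarrow> c t \<ge> 0" and "t \<ge> 0"
  shows "energy (z t) \<le> energy (z 0)"
proof -
  define x p \<xi> where "x = (\<lambda>t. fst (z t))" and "p = (\<lambda>t. fst (snd (z t)))"
    and "\<xi> = (\<lambda>t. snd (snd (z t)))"
  have z: "z = (\<lambda>t. (x t, p t, \<xi> t))"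
    by (simp add: x_def p_def \<xi>_def)
  have "((\<lambda>t. energy (z t)) has_real_derivative
      - c t * (\<gamma> * (norm (p t))\<^sup>2 + \<alpha> * \<rho> * (norm (\<xi> t))\<^sup>2)) (at t within {0..})" if "t \<ge> 0" for t
    unfolding z using dz[OF that] \<rho> unfolding z
    by (intro ikfad_energy_derivative GDERIV_grad) auto
  moreover have "- c t * (\<gamma> * (norm (p t))\<^sup>2 + \<alpha> * \<rho> * (norm (\<xi> t))\<^sup>2) \<le> 0 * energy (z t)"
    if "t \<ge> 0" for t
    using c[OF that] \<gamma> \<alpha> \<rho> by simp
  ultimately have "energy (z t) \<le> energy (z 0) * exp (0 * t)"
    using \<open>t \<ge> 0\<close> by (rule exp_gronwall)
  then show ?thesis by simp
qed

section \<open>Global existence and uniqueness\<close>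

lemma ex_global_solution:
  obtains z where "z 0 = z0"
    "\<And>t. t \<ge> 0 \<Longrightarrow> (z has_vector_derivative field (z t)) (at t within {0..})"
proof -
  obtain R where "R \<ge> 0" and R: "\<And>z. energy z \<le> energy z0 \<Longrightarrow> norm z \<le> R"
    using sublevel_bounded[of "energy z0"] by blast
  obtain L where "L-lipschitz_on (cball 0 (R + 1)) field"
    using ikfad_field_lipschitz[OF C2] .
  then obtain K where
    "K-lipschitz_on UNIV (\<lambda>z. max 0 (min 1 (R + 1 - norm z)) *\<^sub>R field z)"
    "bounded (range (\<lambda>z. max 0 (min 1 (R + 1 - norm z)) *\<^sub>R field z))"
    using lipschitz_cutoff \<open>R \<ge> 0\<close> by blast
  then obtain z where z0: "z 0 = z0"
    and dz: "\<And>t. t \<ge> 0 \<Longrightarrow>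
      (z has_vector_derivative max 0 (min 1 (R + 1 - norm (z t))) *\<^sub>R field (z t)) (at t within {0..})"
    using picard_global[of K _ z0] by blast
  \<comment> \<open>The truncated flow itself dissipates the energy at all times, so
    \<open>norm (z t) \<le> R\<close> follows directly, without a continuation argument.\<close>
  have "max 0 (min 1 (R + 1 - norm (z t))) = 1" if "t \<ge> 0" for t
    using R[of "z t"] energy_nonincreasing[OF dz _ that] z0 by simp
  with z0 dz that show thesis by simp
qed

text \<open>Both solutions start with the same energy, which confines them to one ball on which the
  field is Lipschitz.\<close>

lemma solution_unique:
  assumes dz: "\<And>t. t \<ge> 0 \<Longrightarrow> (z has_vector_derivative field (z t)) (at t within {0..})"
    and dw: "\<And>t. t \<ge> 0 \<Longrightarrow> (w has_vector_derivative field (w t)) (at t within {0..})"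
    and "z 0 = w 0" and "t \<ge> 0"
  shows "z t = w t"
proof -
  obtain R where R: "\<And>y. energy y \<le> energy (w 0) \<Longrightarrow> norm y \<le> R"
    using sublevel_bounded[of "energy (w 0)"] by blast
  have "energy (z t) \<le> energy (z 0)" "energy (w t) \<le> energy (w 0)" if "t \<ge> 0" for t
    using energy_nonincreasing[of _ "\<lambda>_. 1"] dz dw that by auto
  then have "z t \<in> cball 0 R \<and> w t \<in> cball 0 R" if "t \<ge> 0" for t
    using R \<open>z 0 = w 0\<close> that by auto
  moreover obtain L where "L-lipschitz_on (cball 0 R) field"
    using ikfad_field_lipschitz[OF C2] .
  ultimately show ?thesis
    using lipschitz_ode_unique[of L "cball 0 R" field z w t] assms by blast
qed

section \<open>Exponential decay of the energy\<close>

text \<open>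
  The energy alone does not control \<open>x\<close> through its dissipation; adding the small cross term
  \<open>\<epsilon> (x - xstar) \<bullet> p\<close> brings in \<open>- \<epsilon> (x - xstar) \<bullet> grad f x\<close>. The cubic term
  \<open>(x - xstar) \<bullet> (\<xi> * p)\<close> is harmless because the energy bounds \<open>\<xi>\<close> along the solution.
\<close>

lemma energy_exponential_decay:
  assumes dz: "\<And>t. t \<ge> 0 \<Longrightarrow>
      ((\<lambda>t. (x t, p t, \<xi> t)) has_vector_derivative field (x t, p t, \<xi> t)) (at t within {0..})"
  obtains \<kappa> C where "\<kappa> > 0" "C \<ge> 0"
    "\<And>t. t \<ge> 0 \<Longrightarrow> energy (x t, p t, \<xi> t) \<le> C * exp (- \<kappa> * t)"
proof -
  define B where "B = sqrt (2 / \<rho> * energy (x 0, p 0, \<xi> 0))"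
  have "B \<ge> 0"
    using \<rho> energy_bounds(5) by (simp add: B_def)
  have B: "norm (\<xi> t) \<le> B" if "t \<ge> 0" for t
  proof -
    have "energy (x t, p t, \<xi> t) \<le> energy (x 0, p 0, \<xi> 0)"
      using energy_nonincreasing[of "\<lambda>t. (x t, p t, \<xi> t)" "\<lambda>_. 1"] dz that by simp
    then show ?thesis
      unfolding B_def using \<rho>
      by (intro real_le_rsqrt order_trans[OF energy_bounds(4)] mult_left_mono) auto
  qed
  \<comment> \<open>The coefficient that completes the square in
    \<open>(\<gamma> + B) * (u * q) \<le> b * u\<^sup>2 + k * q\<^sup>2\<close>, where
    \<open>u\<close> and \<open>q\<close> are the norms of \<open>x t - xstar\<close> and
    \<open>p t\<close>.\<close>
  define k where "k = (\<gamma> + B)\<^sup>2 / (4 * b)"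
  have "k \<ge> 0" using b by (simp add: k_def)
  \<comment> \<open>The first bound lets the cross term consume at most half of the friction; the
    other two keep it below \<open>H t / 2\<close> in absolute value.\<close>
  define \<epsilon> where "\<epsilon> = min (\<gamma> / (2 * (1 + k))) (min (b / 2) (1 / 2))"
  have \<epsilon>: "\<epsilon> > 0" "\<epsilon> \<le> \<gamma> / (2 * (1 + k))" "\<epsilon> \<le> b / 2" "\<epsilon> \<le> 1 / 2"
    using \<gamma> b \<open>k \<ge> 0\<close> unfolding \<epsilon>_def by (simp, linarith+)
  have \<epsilon>k: "\<epsilon> * (1 + k) \<le> \<gamma> / 2"
    using \<epsilon>(2) \<open>k \<ge> 0\<close> by (simp add: field_simps)
  \<comment> \<open>The rates at which dissipation controls the kinetic, \<open>\<xi>\<close> and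
    potential parts of \<open>H\<close>, half of the friction having been spent.\<close>
  define m where "m = Min {\<gamma>, 2 * \<alpha>, \<epsilon> * a}"
  have m: "m > 0" "m \<le> \<gamma>" "m \<le> 2 * \<alpha>" "m \<le> \<epsilon> * a"
    using \<gamma> \<alpha> a \<epsilon> by (auto simp: m_def)
  define H where "H = (\<lambda>t. energy (x t, p t, \<xi> t))"
  define W where "W = (\<lambda>t. H t + \<epsilon> * ((x t - xstar) \<bullet> p t))"
  define D where "D = (\<lambda>t. - (\<gamma> * (norm (p t))\<^sup>2 + \<alpha> * \<rho> * (norm (\<xi> t))\<^sup>2)
    + \<epsilon> * ((x t - xstar) \<bullet> (- grad f (x t) - \<gamma> *\<^sub>R p t - \<xi> t * p t) + p t \<bullet> p t))"
  have dW: "(W has_real_derivative D t) (at t within {0..})" if "t \<ge> 0" for t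
  proof -
    have "((\<lambda>t. x t - xstar) has_vector_derivative p t) (at t within {0..})"
      and "(p has_vector_derivative (- grad f (x t) - \<gamma> *\<^sub>R p t - \<xi> t * p t)) (at t within {0..})"
      using dz[OF that] by (auto simp: ikfad_field_def has_vector_derivative_Pair_iff
          intro!: derivative_eq_intros)
    moreover have "(H has_real_derivative - (\<gamma> * (norm (p t))\<^sup>2 + \<alpha> * \<rho> * (norm (\<xi> t))\<^sup>2))
        (at t within {0..})"
      using ikfad_energy_derivative[of f x t \<rho> p \<xi> 1 \<gamma> \<alpha> "{0..}" "f xstar"] dz[OF that] \<rho> GDERIV_grad
      by (simp add: H_def)
    ultimately show ?thesis
      unfolding W_def D_def by (intro DERIV_add DERIV_cmult has_real_derivative_inner)
  qed
  have W_H: "H t / 2 \<le> W t \<and> W t \<le> 3 / 2 * H t" for t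
  proof -
    have "\<bar>(x t - xstar) \<bullet> p t\<bar> \<le> norm (x t - xstar) * norm (p t)"
      by (rule Cauchy_Schwarz_ineq2)
    also have "\<dots> \<le> (norm (x t - xstar))\<^sup>2 / 2 + (norm (p t))\<^sup>2 / 2"
      using sum_squares_bound[of "norm (x t - xstar)" "norm (p t)"] by simp
    finally have "\<epsilon> * \<bar>(x t - xstar) \<bullet> p t\<bar>
        \<le> \<epsilon> * ((norm (x t - xstar))\<^sup>2 / 2) + \<epsilon> * ((norm (p t))\<^sup>2 / 2)"
      using \<epsilon>(1) unfolding distrib_left[symmetric] by (intro mult_left_mono) auto
    also have "\<dots> \<le> b / 2 * ((norm (x t - xstar))\<^sup>2 / 2) + 1 / 2 * ((norm (p t))\<^sup>2 / 2)"
      using \<epsilon> by (intro add_mono mult_right_mono) auto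
    also have "\<dots> \<le> H t / 2"
    proof -
      have "0 \<le> \<rho> / 2 * (norm (\<xi> t))\<^sup>2" using \<rho> by simp
      then show ?thesis
        using f_quadratic_growth[of "x t"] by (simp add: H_def ikfad_energy_def)
    qed
    finally have "\<bar>\<epsilon> * ((x t - xstar) \<bullet> p t)\<bar> \<le> H t / 2"
      using \<epsilon>(1) by (simp add: abs_mult)
    then show ?thesis by (auto simp: W_def abs_le_iff)
  qed
  have D_H: "D t \<le> - m * H t" if "t \<ge> 0" for t
  proof -
    define u where "u = norm (x t - xstar)"
    define q where "q = norm (p t)"
    have "- ((x t - xstar) \<bullet> p t) \<le> u * q"
      using Cauchy_Schwarz_ineq2[of "x t - xstar" "p t"] by (simp add: u_def q_def)
    then have 1: "- (\<gamma> * ((x t - xstar) \<bullet> p t)) \<le> \<gamma> * (u * q)"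
      using \<gamma> mult_left_mono[of "- ((x t - xstar) \<bullet> p t)" "u * q" \<gamma>] by simp
    have "- ((x t - xstar) \<bullet> (\<xi> t * p t)) \<le> u * norm (\<xi> t * p t)"
      using Cauchy_Schwarz_ineq2[of "x t - xstar" "\<xi> t * p t"] by (simp add: u_def)
    also have "\<dots> \<le> u * (B * q)"
      using order_trans[OF norm_hadamard_le mult_right_mono[OF B[OF that] norm_ge_zero]]
      by (intro mult_left_mono) (auto simp: u_def q_def)
    finally have 2: "- ((x t - xstar) \<bullet> (\<xi> t * p t)) \<le> u * (B * q)" .
    \<comment> \<open>The gain \<open>b * u\<^sup>2\<close> is used up entirely in absorbing the
      mixed terms of \<open>1\<close> and \<open>2\<close>; the potential term is left for the
      decay.\<close>
    have 3: "- ((x t - xstar) \<bullet> grad f (x t)) \<le> - a * (f (x t) - f xstar) - b * u\<^sup>2"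
      using strong[of "x t"] by (simp add: grad_xstar u_def)
    have 4: "(\<gamma> + B) * (u * q) \<le> b * u\<^sup>2 + k * q\<^sup>2"
    proof -
      have "0 \<le> (2 * b * u - (\<gamma> + B) * q)\<^sup>2 / (4 * b)"
        using b by simp
      also have "\<dots> = b * u\<^sup>2 + k * q\<^sup>2 - (\<gamma> + B) * (u * q)"
        using b by (simp add: k_def power2_eq_square field_simps)
      finally show ?thesis by simp
    qed
    have "(x t - xstar) \<bullet> (- grad f (x t) - \<gamma> *\<^sub>R p t - \<xi> t * p t) + p t \<bullet> p t
        \<le> - a * (f (x t) - f xstar) + (1 + k) * q\<^sup>2"
      using 1 2 3 4
      by (simp add: inner_diff_right dot_square_norm q_def[symmetric] algebra_simps)
    then have "\<epsilon> * ((x t - xstar) \<bullet> (- grad f (x t) - \<gamma> *\<^sub>R p t - \<xi> t * p t) + p t \<bullet> p t)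
        \<le> \<epsilon> * (- a * (f (x t) - f xstar) + (1 + k) * q\<^sup>2)"
      using \<epsilon>(1) by (intro mult_left_mono) auto
    also have "\<dots> \<le> - (\<epsilon> * a) * (f (x t) - f xstar) + \<gamma> / 2 * q\<^sup>2"
      using mult_right_mono[OF \<epsilon>k, of "q\<^sup>2"] by (simp add: algebra_simps)
    finally have "D t \<le> - (\<epsilon> * a) * (f (x t) - f xstar) - \<gamma> / 2 * q\<^sup>2 - \<alpha> * \<rho> * (norm (\<xi> t))\<^sup>2"
      by (simp add: D_def q_def[symmetric])
    moreover have "m * (f (x t) - f xstar) \<le> \<epsilon> * a * (f (x t) - f xstar)"
      using m(4) f_ge by (intro mult_right_mono) auto
    moreover have "m * q\<^sup>2 \<le> \<gamma> * q\<^sup>2"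
      using m(2) by (intro mult_right_mono) auto
    moreover have "m * (\<rho> * (norm (\<xi> t))\<^sup>2) \<le> 2 * \<alpha> * (\<rho> * (norm (\<xi> t))\<^sup>2)"
      using m(3) \<rho> by (intro mult_right_mono) auto
    ultimately show ?thesis
      by (simp add: H_def ikfad_energy_def q_def[symmetric] algebra_simps)
  qed
  have H0: "0 \<le> H t" for t
    unfolding H_def by (rule energy_bounds)
  \<comment> \<open>Passing from \<open>H\<close> to \<open>W\<close> costs the factor 2/3, since
    \<open>W t \<le> 3 / 2 * H t\<close>; returning at the end costs the factor 2 in the
    constant.\<close>
  have "D t \<le> - (2 / 3 * m) * W t" if "t \<ge> 0" for t
  proof -
    have "2 / 3 * m * W t \<le> 2 / 3 * m * (3 / 2 * H t)"
      using W_H[of t] m(1) by (intro mult_left_mono) auto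
    then show ?thesis using D_H[OF that] by simp
  qed
  then have decay: "W t \<le> W 0 * exp (- (2 / 3 * m) * t)" if "t \<ge> 0" for t
    using exp_gronwall[of W D "- (2 / 3 * m)" t] dW that by blast
  show thesis
  proof
    show "2 / 3 * m > 0" using m(1) by simp
    show "2 * W 0 \<ge> 0" using W_H[of 0] H0[of 0] by simp
    show "energy (x t, p t, \<xi> t) \<le> 2 * W 0 * exp (- (2 / 3 * m) * t)" if "t \<ge> 0" for t
      using decay[OF that] W_H[of t] by (simp add: H_def)
  qed
qed

end

section \<open>Existence, uniqueness and decay for the iKFAD system\<close>

text \<open>"The solution" is rendered as existence together with agreement of every other solution
  at nonnegative times. The constants are quantified after the initial condition and may depend on
  it.\<close>

theorem theorem1:
  fixes f :: "real ^ 'n \<Rightarrow> real" and xstar :: "real ^ 'n"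
    and a b \<gamma> \<alpha> \<rho> :: real
    and x0 p0 \<xi>0 :: "real ^ 'n"
  assumes "C2_function f"
    and "unique_global_minimum f xstar"
    and "a > 0" and "b > 0"
    and "\<And>x. a * (f x - f xstar) + b * (norm (x - xstar))\<^sup>2
              \<le> (x - xstar) \<bullet> (grad f x - grad f xstar)"
    and "\<gamma> > 0" and "\<alpha> > 0" and "\<rho> > 0"
    and "\<And>i. \<xi>0 $ i \<ge> 0"
  shows "\<exists>x p \<xi>.
     ikfad_solution f \<gamma> \<alpha> \<rho> x0 p0 \<xi>0 x p \<xi> \<and>
     (\<forall>y q \<eta>. ikfad_solution f \<gamma> \<alpha> \<rho> x0 p0 \<xi>0 y q \<eta> \<longrightarrow>
        (\<forall>t\<ge>0. y t = x t \<and> q t = p t \<and> \<eta> t = \<xi> t)) \<and>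
     (\<exists>\<kappa>>0. \<exists>C\<ge>0. \<forall>t\<ge>0.
        f (x t) - f xstar + norm (p t) + norm (\<xi> t) \<le> C * exp (- \<kappa> * t))"
proof -
  interpret ikfad f xstar a b \<gamma> \<alpha> \<rho>
    using assms by unfold_locales
  obtain z where z0: "z 0 = (x0, p0, \<xi>0)"
    and dz: "\<And>t. t \<ge> 0 \<Longrightarrow> (z has_vector_derivative field (z t)) (at t within {0..})"
    using ex_global_solution[of "(x0, p0, \<xi>0)"] by blast
  define x p \<xi> where "x = (\<lambda>t. fst (z t))" and "p = (\<lambda>t. fst (snd (z t)))"
    and "\<xi> = (\<lambda>t. snd (snd (z t)))"
  have z: "z = (\<lambda>t. (x t, p t, \<xi> t))"
    by (simp add: x_def p_def \<xi>_def)
  have "ikfad_solution f \<gamma> \<alpha> \<rho> x0 p0 \<xi>0 x p \<xi>"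
    using z0 dz unfolding ikfad_solution_iff z by simp
  moreover have "y t = x t \<and> q t = p t \<and> \<eta> t = \<xi> t"
    if "ikfad_solution f \<gamma> \<alpha> \<rho> x0 p0 \<xi>0 y q \<eta>" "t \<ge> 0" for y q \<eta> t
  proof -
    have "(y t, q t, \<eta> t) = z t"
      using solution_unique[of "\<lambda>t. (y t, q t, \<eta> t)" z t] that z0 dz
      by (simp add: ikfad_solution_iff)
    then show ?thesis by (simp add: z)
  qed
  moreover have "\<exists>\<kappa>>0. \<exists>C\<ge>0. \<forall>t\<ge>0.
      f (x t) - f xstar + norm (p t) + norm (\<xi> t) \<le> C * exp (- \<kappa> * t)"
  proof -
    obtain \<kappa> C where "\<kappa> > 0" "C \<ge> 0"
      and C: "\<And>t. t \<ge> 0 \<Longrightarrow> energy (x t, p t, \<xi> t) \<le> C * exp (- \<kappa> * t)"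
      using energy_exponential_decay dz unfolding z by blast
    \<comment> \<open>The energy controls the squares of the norms of \<open>p\<close> and
      \<open>\<xi>\<close>, so taking square roots halves the rate; the potential part decays at the
      full rate and is weakened by \<open>e\<^sup>2 \<le> e\<close>.\<close>
    have "f (x t) - f xstar + norm (p t) + norm (\<xi> t)
        \<le> (C + sqrt (2 * C) + sqrt (2 / \<rho> * C)) * exp (- (\<kappa> / 2) * t)" if "t \<ge> 0" for t
    proof -
      define e where "e = exp (- (\<kappa> / 2) * t)"
      have e2: "exp (- \<kappa> * t) = e\<^sup>2"
        by (simp add: e_def exp_double[symmetric])
      have "0 < e" "e \<le> 1"
        using \<open>\<kappa> > 0\<close> that by (auto simp: e_def)
      have E: "energy (x t, p t, \<xi> t) \<le> C * e\<^sup>2"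
        using C[OF that] by (simp only: e2)
      have "e\<^sup>2 \<le> e"
        using \<open>0 < e\<close> \<open>e \<le> 1\<close> by (simp add: power2_eq_square)
      then have "f (x t) - f xstar \<le> C * e"
        using energy_bounds(1)[where x = "x t" and p = "p t" and \<xi> = "\<xi> t"] E mult_left_mono[of "e\<^sup>2" e C] \<open>C \<ge> 0\<close>
        by linarith
      moreover have "norm (p t) \<le> sqrt (2 * C * e\<^sup>2)"
        using energy_bounds(3)[where x = "x t" and p = "p t" and \<xi> = "\<xi> t"] E
        by (intro real_le_rsqrt) simp
      moreover have "norm (\<xi> t) \<le> sqrt (2 / \<rho> * (C * e\<^sup>2))"
        using E \<open>\<rho> > 0\<close>
        by (intro real_le_rsqrt order_trans[OF energy_bounds(4)] mult_left_mono) auto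
      ultimately show ?thesis
        using \<open>0 < e\<close> unfolding e_def[symmetric]
        by (simp add: real_sqrt_mult real_sqrt_divide distrib_right)
    qed
    moreover have "C + sqrt (2 * C) + sqrt (2 / \<rho> * C) \<ge> 0"
      using \<open>C \<ge> 0\<close> \<open>\<rho> > 0\<close> by simp
    ultimately show ?thesis
      using \<open>\<kappa> > 0\<close> by (intro exI[of _ "\<kappa> / 2"]) auto
  qed
  ultimately show ?thesis by blast
qed

end
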